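(* Let $p,q\ge1$, $n=p+q$, and let $\mathbf S$ be the spin module attached to the Levi subalgebra $\mathfrak h=\mathfrak h(p,q)$ of $\mathfrak{sl}(n,\mathbb C)$. Let $\mathcal P'=\{(\alpha,\beta)\in\mathcal P:\beta\preceq{}^t\alpha\}$, and let $\Lambda'(\mathbf S)\subset\Lambda(\mathbf S)$ be the subset of weights $\mu=(\mu_1,\ldots,\mu_p,\nu_1,\ldots,\nu_q)$ satisfying $\mu_1\ge\cdots\ge\mu_p$ and $\nu_1\ge\cdots\ge\nu_q$. Then the map $$\mathcal P'\to\Lambda'(\mathbf S),\quad(\alpha,\beta)\mapsto\mu(\alpha,\beta)$$ is bijective.
   Context: Let $\mathfrak{g}=\mathfrak{sl}(n,\mathbb{C})$, $\mathfrak{t}$ the diagonal Cartan subalgebra, $\epsilon_i\in\mathfrak{t}^*$ the functional $\mathrm{diag}(t_1,\ldots,t_n)\mapsto t_i$. $\mathfrak h(p,q)$ is the subalgebra of block-diagonal matrices with diagonal blocks of sizes $p$ and $q$; its Killing-orthogonal complement is $\mathfrak q$, with positive roots $\Phi^+(\mathfrak q)=\{\epsilon_i-\epsilon_j:1\le i\le p<j\le n\}$. The spin module is $\mathbf S=\bigwedge\mathfrak u^+$, $\mathfrak u^+=\bigoplus_{\alpha\in\Phi^+(\mathfrak q)}\mathfrak g_\alpha$, with $\mathfrak h$ acting through $\mathfrak h\xrightarrow{\mathrm{ad}}\mathfrak{so}(\mathfrak q)\subset\mathbf C(\mathfrak q)\to\mathrm{End}(\mathbf S)$ (Clifford multiplication).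 Its set of weights is $\Lambda(\mathbf S)=\{\mu(A):A\subset\Phi^+(\mathfrak q)\}$, $\mu(A)=\frac12\big(\sum_{\alpha\in\Phi^+(\mathfrak q)\setminus A}\alpha-\sum_{\alpha\in A}\alpha\big)$. A weight $\sum b_i\epsilon_i$ of $\mathbf S$ is identified with the $n$-tuple $(b_1,\ldots,b_n)$ (with $\sum b_i=0$). $\mathcal P$ is the set of pairs $(\alpha,\beta)$ such that, for some $0\le m\le pq$, $\alpha$ is a partition of $m$ with at most $p$ parts and $\beta$ is a partition of $m$ with at most $q$ parts; write $\alpha=(\alpha_1\ge\cdots\ge\alpha_p\ge0)$, $\beta=(\beta_1\ge\cdots\ge\beta_q\ge0)$. ${}^t\alpha$ is the dual (conjugate) partition and $\preceq$ is the dominance order on partitions of the same integer ($\lambda\preceq\lambda'$ iff $\lambda_1+\cdots+\lambda_i\le\lambda_1'+\cdots+\lambda_i'$ for all $i$, padding with zeros). Put $\mu(\alpha,\beta)=\big(\alpha_1-\tfrac q2,\ldots,\alpha_p-\tfrac q2,\tfrac p2-\beta_q,\ldots,\tfrac p2-\beta_1\big)$. *)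

theory Defs
  imports Complex_Main "HOL-Library.Complex_Order" "Jordan_Normal_Form.Matrix"
begin

text \<open>
  All indices are shifted by one: the coordinates of an \<open>n\<close>-tuple, the rows and columns of a
  matrix and the parts of a partition are numbered from \<open>0\<close>.  The two diagonal blocks
  of \<open>\<hh>(p,q)\<close> are the index sets \<open>{0..<p}\<close> and \<open>{p..<p+q}\<close>.
\<close>

section \<open>The Levi subalgebra and its orthogonal complement\<close>

definition lie :: "complex mat \<Rightarrow> complex mat \<Rightarrow> complex mat" where
  "lie X Y = X * Y - Y * X"

definition mat_unit :: "nat \<Rightarrow> nat \<Rightarrow> nat \<Rightarrow> complex mat" where
  "mat_unit n i j = mat n n (\<lambda>(k, l). if k = i \<and> l = j then 1 else 0)"

definition sl :: "nat \<Rightarrow> complex mat set" where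
  "sl n = {X \<in> carrier_mat n n. (\<Sum>i<n. X $$ (i, i)) = 0}"

definition cartan :: "nat \<Rightarrow> complex mat set" where
  "cartan n = {H \<in> sl n. \<forall>i<n. \<forall>j<n. i \<noteq> j \<longrightarrow> H $$ (i, j) = 0}"

definition levi :: "nat \<Rightarrow> nat \<Rightarrow> complex mat set" where
  "levi p q = {X \<in> sl (p + q). \<forall>i<p+q. \<forall>j<p+q. (i < p) \<noteq> (j < p) \<longrightarrow> X $$ (i, j) = 0}"

text \<open>
  The trace of \<open>ad X \<circ> ad Y\<close>, computed in the basis of matrix units of \<open>\<gg>\<ll>(n)\<close>.  Since
  \<open>\<gg>\<ll>(n) = \<ss>\<ll>(n) \<oplus> \<complex> 1\<close> and \<open>ad Y\<close> kills \<open>1\<close>, this is the trace on \<open>\<ss>\<ll>(n)\<close>.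
\<close>
definition killing :: "nat \<Rightarrow> complex mat \<Rightarrow> complex mat \<Rightarrow> complex" where
  "killing n X Y = (\<Sum>i<n. \<Sum>j<n. lie X (lie Y (mat_unit n i j)) $$ (i, j))"

definition levi_perp :: "nat \<Rightarrow> nat \<Rightarrow> complex mat set" where
  "levi_perp p q = {X \<in> sl (p + q). \<forall>Y \<in> levi p q. killing (p + q) X Y = 0}"

text \<open>
  The pair \<open>(i, j)\<close> stands for the root \<open>\<epsilon>\<^sub>i - \<epsilon>\<^sub>j\<close>, whose root space is spanned by
  \<open>mat_unit n i j\<close>.
\<close>
definition perp_roots :: "nat \<Rightarrow> nat \<Rightarrow> (nat \<times> nat) set" where
  "perp_roots p q =
    {(i, j). i < p + q \<and> j < p + q \<and> i \<noteq> j \<and> mat_unit (p + q) i j \<in> levi_perp p q}"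

definition pos_roots :: "nat \<Rightarrow> nat \<Rightarrow> (nat \<times> nat) set" where
  "pos_roots p q = {0..<p} \<times> {p..<p+q}"

section \<open>The spin module\<close>

text \<open>
  An element of the exterior algebra of \<open>\<uu>\<^sup>+\<close> is given by its coordinates in the basis \<open>e\<^sub>A\<close>,
  \<open>A \<subseteq> \<Phi>\<^sup>+(\<qq>)\<close>, where \<open>e\<^sub>A\<close> is the exterior product of the \<open>mat_unit n i j\<close>, \<open>(i, j) \<in> A\<close>,
  taken in lexicographically increasing order.
\<close>
definition spin_module :: "nat \<Rightarrow> nat \<Rightarrow> ((nat \<times> nat) set \<Rightarrow> complex) set" where
  "spin_module p q = {\<omega>. \<forall>A. \<omega> A \<noteq> 0 \<longrightarrow> A \<subseteq> pos_roots p q}"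

text \<open>The sign picked up when moving the basis vector \<open>\<alpha>\<close> to its position in \<open>e\<^sub>A\<close>.\<close>
definition ext_sign :: "nat \<times> nat \<Rightarrow> (nat \<times> nat) set \<Rightarrow> complex" where
  "ext_sign \<alpha> A = (-1) ^ card {\<beta> \<in> A. (\<beta>, \<alpha>) \<in> less_than <*lex*> less_than}"

text \<open>\<open>wedge \<alpha>\<close> is left exterior multiplication by the basis vector \<open>\<alpha>\<close>.\<close>
definition wedge ::
  "nat \<times> nat \<Rightarrow> ((nat \<times> nat) set \<Rightarrow> complex) \<Rightarrow> (nat \<times> nat) set \<Rightarrow> complex" where
  "wedge \<alpha> \<omega> = (\<lambda>A. if \<alpha> \<in> A then ext_sign \<alpha> A * \<omega> (A - {\<alpha>}) else 0)"

text \<open>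
  \<open>contract \<alpha>\<close> is contraction by the element of the dual basis belonging to \<open>\<alpha>\<close>: the
  antiderivation of degree \<open>-1\<close> that sends the basis vector \<open>\<alpha>\<close> to \<open>1\<close> and the others to \<open>0\<close>.
\<close>
definition contract ::
  "nat \<times> nat \<Rightarrow> ((nat \<times> nat) set \<Rightarrow> complex) \<Rightarrow> (nat \<times> nat) set \<Rightarrow> complex" where
  "contract \<alpha> \<omega> = (\<lambda>A. if \<alpha> \<notin> A then ext_sign \<alpha> A * \<omega> (insert \<alpha> A) else 0)"

text \<open>
  Clifford multiplication by \<open>X = X\<^sup>+ + X\<^sup>-\<close> in \<open>\<qq> = \<uu>\<^sup>+ \<oplus> \<uu>\<^sup>-\<close>: exterior multiplication by \<open>X\<^sup>+\<close> plus
  twice the contraction by the functional \<open>B(X\<^sup>-, _) = B(X, _)\<close> on \<open>\<uu>\<^sup>+\<close>, where \<open>B\<close> is the Killing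
  form.  The Clifford relation is normalised as \<open>X Y + Y X = 2 B(X, Y)\<close>.
\<close>
definition clifford_mult ::
  "nat \<Rightarrow> nat \<Rightarrow> complex mat \<Rightarrow> ((nat \<times> nat) set \<Rightarrow> complex) \<Rightarrow> (nat \<times> nat) set \<Rightarrow> complex" where
  "clifford_mult p q X \<omega> = (\<lambda>A. \<Sum>(i, j) \<in> pos_roots p q.
      X $$ (i, j) * wedge (i, j) \<omega> A
      + 2 * killing (p + q) X (mat_unit (p + q) i j) * contract (i, j) \<omega> A)"

text \<open>
  With this normalisation the embedding of \<open>\<ss>\<oo>(\<qq>)\<close> into the Clifford algebra sends \<open>T\<close> to
  \<open>1/4 \<Sum>\<^sub>k T(b\<^sub>k) b\<^sup>k\<close> for any pair of dual bases of \<open>\<qq>\<close>, so that the commutator with the image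
  of \<open>T\<close> is \<open>T\<close> on \<open>\<qq>\<close>.  Here \<open>T = ad X\<close>, the \<open>b\<^sub>k\<close> are the matrix units in \<open>\<qq>\<close>, and the
  element dual to \<open>mat_unit n i j\<close> is a multiple of \<open>mat_unit n j i\<close>.
\<close>
definition spin_action ::
  "nat \<Rightarrow> nat \<Rightarrow> complex mat \<Rightarrow> ((nat \<times> nat) set \<Rightarrow> complex) \<Rightarrow> (nat \<times> nat) set \<Rightarrow> complex" where
  "spin_action p q X \<omega> = (\<lambda>A. 1 / 4 * (\<Sum>(i, j) \<in> perp_roots p q.
      1 / killing (p + q) (mat_unit (p + q) i j) (mat_unit (p + q) j i)
      * clifford_mult p q (lie X (mat_unit (p + q) i j))
          (clifford_mult p q (mat_unit (p + q) j i) \<omega>) A))"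

text \<open>
  The weights of the spin module with respect to the diagonal Cartan subalgebra.  A functional on
  the traceless diagonal matrices is \<open>\<Sum>\<^sub>i b\<^sub>i \<epsilon>\<^sub>i\<close> for exactly one tuple \<open>b\<close> with \<open>\<Sum>\<^sub>i b\<^sub>i = 0\<close>.
\<close>
definition spin_weights :: "nat \<Rightarrow> nat \<Rightarrow> complex vec set" where
  "spin_weights p q = {b \<in> carrier_vec (p + q). (\<Sum>i<p+q. b $ i) = 0 \<and>
     (\<exists>\<omega> \<in> spin_module p q. \<omega> \<noteq> (\<lambda>A. 0) \<and>
        (\<forall>H \<in> cartan (p + q).
           spin_action p q H \<omega> = (\<lambda>A. (\<Sum>i<p+q. b $ i * H $$ (i, i)) * \<omega> A)))}"

text \<open>
  The order on \<open>complex\<close> is the one of \<open>Complex_Order\<close>: \<open>z \<le> w\<close> means that \<open>w - z\<close> is a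
  nonnegative real number.
\<close>
definition dominant_spin_weights :: "nat \<Rightarrow> nat \<Rightarrow> complex vec set" where
  "dominant_spin_weights p q = {b \<in> spin_weights p q.
     (\<forall>i j. i \<le> j \<and> j < p \<longrightarrow> b $ i \<ge> b $ j) \<and>
     (\<forall>i j. p \<le> i \<and> i \<le> j \<and> j < p + q \<longrightarrow> b $ i \<ge> b $ j)}"

section \<open>Pairs of partitions\<close>

text \<open>A partition is a weakly decreasing sequence of natural numbers, padded with zeros.\<close>
definition is_partition_of :: "nat \<Rightarrow> (nat \<Rightarrow> nat) \<Rightarrow> bool" where
  "is_partition_of m a \<longleftrightarrow> antimono a \<and> finite {i. a i \<noteq> 0} \<and> (\<Sum>i | a i \<noteq> 0. a i) = m"

definition num_parts :: "(nat \<Rightarrow> nat) \<Rightarrow> nat" where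
  "num_parts a = card {i. a i \<noteq> 0}"

definition conjugate_partition :: "(nat \<Rightarrow> nat) \<Rightarrow> nat \<Rightarrow> nat" where
  "conjugate_partition a j = card {i. j < a i}"

definition dominance_le :: "(nat \<Rightarrow> nat) \<Rightarrow> (nat \<Rightarrow> nat) \<Rightarrow> bool" where
  "dominance_le a b \<longleftrightarrow> (\<forall>k. (\<Sum>i<k. a i) \<le> (\<Sum>i<k. b i))"

definition partition_pairs :: "nat \<Rightarrow> nat \<Rightarrow> ((nat \<Rightarrow> nat) \<times> (nat \<Rightarrow> nat)) set" where
  "partition_pairs p q = {(a, b). \<exists>m \<le> p * q.
     is_partition_of m a \<and> num_parts a \<le> p \<and> is_partition_of m b \<and> num_parts b \<le> q}"

definition dominance_pairs :: "nat \<Rightarrow> nat \<Rightarrow> ((nat \<Rightarrow> nat) \<times> (nat \<Rightarrow> nat)) set" where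
  "dominance_pairs p q =
    {(a, b) \<in> partition_pairs p q. dominance_le b (conjugate_partition a)}"

definition pair_weight :: "nat \<Rightarrow> nat \<Rightarrow> (nat \<Rightarrow> nat) \<Rightarrow> (nat \<Rightarrow> nat) \<Rightarrow> complex vec" where
  "pair_weight p q a b = vec (p + q) (\<lambda>i.
     if i < p then of_nat (a i) - of_nat q / 2 else of_nat p / 2 - of_nat (b (p + q - 1 - i)))"

end

theory Submission
  imports Defs
begin

text \<open>
  The basis vector \<open>e\<^sub>A\<close> is a weight vector: each root \<open>\<alpha>\<close> contributes the two operators
  \<open>wedge \<alpha> \<circ> contract \<alpha>\<close> and \<open>contract \<alpha> \<circ> wedge \<alpha>\<close>, the projections to \<open>\<alpha> \<in> A\<close> and
  \<open>\<alpha> \<notin> A\<close>, with coefficients \<open>\<alpha>(H)/2\<close> and \<open>-\<alpha>(H)/2\<close>.  Reading \<open>A\<close> as a \<open>p \<times> q\<close> matrix of zeros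
  and ones, its weight is \<open>\<mu>(a, b)\<close> for the vectors \<open>a\<close> of row sums and \<open>b\<close> of column sums
  (columns taken in reverse order).  By the Gale-Ryser theorem a pair of partitions arises in this way
  exactly when \<open>b\<close> is dominated by the conjugate of \<open>a\<close>.
\<close>

section \<open>The torus action on the spin module\<close>

lemma mat_unit_carrier [simp]: "mat_unit n i j \<in> carrier_mat n n"
  by (simp add: mat_unit_def)

lemma lie_carrier: "X \<in> carrier_mat n n \<Longrightarrow> Y \<in> carrier_mat n n \<Longrightarrow> lie X Y \<in> carrier_mat n n"
  unfolding lie_def by (intro minus_carrier_mat mult_carrier_mat)

lemma mat_unit_index:
  "k < n \<Longrightarrow> l < n \<Longrightarrow> mat_unit n i j $$ (k, l) = (if k = i \<and> l = j then 1 else 0)"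
  by (simp add: mat_unit_def)

lemma smult_mat_unit_index:
  "k < n \<Longrightarrow> l < n \<Longrightarrow> (c \<cdot>\<^sub>m mat_unit n i j) $$ (k, l) = (if k = i \<and> l = j then c else 0)"
  by (simp add: mat_unit_def)

lemma mult_mat_index:
  "X \<in> carrier_mat n n \<Longrightarrow> Y \<in> carrier_mat n n \<Longrightarrow> k < n \<Longrightarrow> l < n \<Longrightarrow>
    (X * Y) $$ (k, l) = (\<Sum>m<n. X $$ (k, m) * Y $$ (m, l))"
  by (auto simp: scalar_prod_def atLeast0LessThan intro!: sum.cong)

lemma lie_index:
  assumes "X \<in> carrier_mat n n" "Y \<in> carrier_mat n n" "k < n" "l < n"
  shows "lie X Y $$ (k, l) = (\<Sum>m<n. X $$ (k, m) * Y $$ (m, l)) - (\<Sum>m<n. Y $$ (k, m) * X $$ (m, l))"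
proof -
  have "lie X Y $$ (k, l) = (X * Y) $$ (k, l) - (Y * X) $$ (k, l)"
    unfolding lie_def using assms by (intro index_minus_mat) auto
  then show ?thesis using assms by (simp only: mult_mat_index)
qed

lemma lie_mat_unit_index:
  assumes "X \<in> carrier_mat n n" "i < n" "j < n" "k < n" "l < n"
  shows "lie X (mat_unit n i j) $$ (k, l) =
    (if l = j then X $$ (k, i) else 0) - (if k = i then X $$ (j, l) else 0)"
proof -
  have "(\<Sum>m<n. X $$ (k, m) * mat_unit n i j $$ (m, l)) =
      (\<Sum>m<n. if m = i then (if l = j then X $$ (k, i) else 0) else 0)"
    using assms by (intro sum.cong) (auto simp: mat_unit_index)
  moreover have "(\<Sum>m<n. mat_unit n i j $$ (k, m) * X $$ (m, l)) =
      (\<Sum>m<n. if m = j then (if k = i then X $$ (j, l) else 0) else 0)"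
    using assms by (intro sum.cong) (auto simp: mat_unit_index)
  ultimately show ?thesis using assms by (simp add: lie_index)
qed

text \<open>The diagonal coefficient of \<open>ad X \<circ> ad Y\<close> at \<open>E_ij\<close> is
  \<open>(XY)_ii + (YX)_jj - X_ii Y_jj - Y_ii X_jj\<close>; summing over i and j gives
  \<open>2n tr(XY) - 2 tr X tr Y\<close>, the Killing form of gl(n).\<close>

lemma killing_eq_trace:
  assumes X: "X \<in> carrier_mat n n" and Y: "Y \<in> carrier_mat n n"
  shows "killing n X Y = 2 * of_nat n * (\<Sum>i<n. \<Sum>k<n. X $$ (i, k) * Y $$ (k, i))
    - 2 * (\<Sum>i<n. X $$ (i, i)) * (\<Sum>i<n. Y $$ (i, i))"
proof -
  have entry: "lie X (lie Y (mat_unit n i j)) $$ (i, j) =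
      (\<Sum>k<n. X $$ (i, k) * Y $$ (k, i)) + (\<Sum>k<n. X $$ (k, j) * Y $$ (j, k))
      - X $$ (i, i) * Y $$ (j, j) - Y $$ (i, i) * X $$ (j, j)" if "i < n" "j < n" for i j
  proof -
    have "(\<Sum>k<n. X $$ (i, k) * lie Y (mat_unit n i j) $$ (k, j)) =
        (\<Sum>k<n. X $$ (i, k) * Y $$ (k, i) - (if k = i then X $$ (i, i) * Y $$ (j, j) else 0))"
      using that Y by (intro sum.cong) (auto simp: lie_mat_unit_index algebra_simps)
    moreover have "(\<Sum>k<n. lie Y (mat_unit n i j) $$ (i, k) * X $$ (k, j)) =
        (\<Sum>k<n. (if k = j then Y $$ (i, i) * X $$ (j, j) else 0) - X $$ (k, j) * Y $$ (j, k))"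
      using that Y by (intro sum.cong) (auto simp: lie_mat_unit_index algebra_simps)
    moreover have "lie Y (mat_unit n i j) \<in> carrier_mat n n"
      using Y by (simp add: lie_carrier)
    ultimately show ?thesis using that X by (simp add: lie_index sum_subtractf)
  qed
  have "killing n X Y = (\<Sum>i<n. \<Sum>j<n. (\<Sum>k<n. X $$ (i, k) * Y $$ (k, i)) + (\<Sum>k<n. X $$ (k, j) * Y $$ (j, k))
      - X $$ (i, i) * Y $$ (j, j) - Y $$ (i, i) * X $$ (j, j))"
    unfolding killing_def by (intro sum.cong) (simp_all add: entry)
  also have "\<dots> = of_nat n * (\<Sum>i<n. \<Sum>k<n. X $$ (i, k) * Y $$ (k, i)) + of_nat n * (\<Sum>j<n. \<Sum>k<n. X $$ (k, j) * Y $$ (j, k))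
      - (\<Sum>i<n. X $$ (i, i)) * (\<Sum>i<n. Y $$ (i, i)) - (\<Sum>i<n. Y $$ (i, i)) * (\<Sum>i<n. X $$ (i, i))"
    by (simp add: sum.distrib sum_subtractf sum_product flip: sum_distrib_left)
  also have "(\<Sum>j<n. \<Sum>k<n. X $$ (k, j) * Y $$ (j, k)) = (\<Sum>i<n. \<Sum>k<n. X $$ (i, k) * Y $$ (k, i))"
    by (rule sum.swap)
  finally show ?thesis by (simp add: algebra_simps)
qed

text \<open>An off-diagonal matrix unit is traceless, so only the \<open>tr(XY)\<close> term
  survives. The scalar \<open>c\<close> is carried along because brackets with torus elements
  produce multiples of matrix units.\<close>

lemma killing_root_vector:
  assumes "i < n" "j < n" "i \<noteq> j" "Y \<in> carrier_mat n n"
  shows "killing n (c \<cdot>\<^sub>m mat_unit n i j) Y = 2 * of_nat n * c * Y $$ (j, i)"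
proof -
  have "(\<Sum>k<n. \<Sum>l<n. (c \<cdot>\<^sub>m mat_unit n i j) $$ (k, l) * Y $$ (l, k))
      = (\<Sum>k<n. if k = i then c * Y $$ (j, i) else 0)"
  proof (intro sum.cong refl)
    fix k assume "k \<in> {..<n}"
    then have "(\<Sum>l<n. (c \<cdot>\<^sub>m mat_unit n i j) $$ (k, l) * Y $$ (l, k)) =
        (\<Sum>l<n. if l = j then (if k = i then c * Y $$ (j, i) else 0) else 0)"
      by (intro sum.cong) (auto simp: smult_mat_unit_index)
    then show "(\<Sum>l<n. (c \<cdot>\<^sub>m mat_unit n i j) $$ (k, l) * Y $$ (l, k)) = (if k = i then c * Y $$ (j, i) else 0)"
      using assms by simp
  qed
  moreover have "(\<Sum>k<n. (c \<cdot>\<^sub>m mat_unit n i j) $$ (k, k)) = 0"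
    using assms by (auto simp: smult_mat_unit_index intro!: sum.neutral)
  ultimately show ?thesis using assms by (simp add: killing_eq_trace)
qed

lemma killing_mat_unit:
  assumes "i < n" "j < n" "i \<noteq> j" "Y \<in> carrier_mat n n"
  shows "killing n (mat_unit n i j) Y = 2 * of_nat n * Y $$ (j, i)"
proof -
  have "1 \<cdot>\<^sub>m mat_unit n i j = mat_unit n i j" by auto
  then show ?thesis using killing_root_vector[OF assms, of 1] by simp
qed

lemma mat_unit_in_sl: "i \<noteq> j \<Longrightarrow> mat_unit n i j \<in> sl n"
  by (auto simp: sl_def mat_unit_index intro!: sum.neutral)

text \<open>If i and j lie in the same block, the transposed matrix unit lies in the Levi subalgebra
  and pairs to 2n with \<open>E_ij\<close>. If they lie in different blocks, \<open>E_ij\<close>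
  pairs with \<open>Y\<close> through an entry that vanishes on the Levi subalgebra.\<close>

lemma perp_roots_eq: "perp_roots p q = pos_roots p q \<union> {p..<p+q} \<times> {0..<p}"
proof -
  have "mat_unit (p+q) i j \<in> levi_perp p q \<longleftrightarrow> (i < p) \<noteq> (j < p)"
    if ij: "i < p+q" "j < p+q" "i \<noteq> j" for i j
  proof
    assume perp: "mat_unit (p+q) i j \<in> levi_perp p q"
    show "(i < p) \<noteq> (j < p)"
    proof (rule ccontr)
      assume "\<not> ?thesis"
      then have "mat_unit (p+q) j i \<in> levi p q"
        using ij mat_unit_in_sl[of j i] by (auto simp: levi_def mat_unit_index)
      with perp have "killing (p+q) (mat_unit (p+q) i j) (mat_unit (p+q) j i) = 0"
        by (auto simp: levi_perp_def)
      then show False using ij by (simp add: killing_mat_unit mat_unit_index flip: of_nat_add)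
    qed
  next
    assume "(i < p) \<noteq> (j < p)"
    then show "mat_unit (p+q) i j \<in> levi_perp p q"
      using ij by (auto simp: levi_perp_def levi_def sl_def killing_mat_unit mat_unit_index
          intro!: sum.neutral split: if_splits)
  qed
  then show ?thesis by (auto simp: perp_roots_def pos_roots_def)
qed

lemma lie_cartan_mat_unit:
  assumes "H \<in> cartan n" "i < n" "j < n"
  shows "lie H (mat_unit n i j) = (H $$ (i, i) - H $$ (j, j)) \<cdot>\<^sub>m mat_unit n i j"
proof -
  have H: "H \<in> carrier_mat n n" and diag: "\<And>k l. k < n \<Longrightarrow> l < n \<Longrightarrow> k \<noteq> l \<Longrightarrow> H $$ (k, l) = 0"
    using assms by (auto simp: cartan_def sl_def)
  have "dim_row (lie H (mat_unit n i j)) = n" "dim_col (lie H (mat_unit n i j)) = n"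
    using lie_carrier[OF H mat_unit_carrier] by auto
  then show ?thesis
    using assms(2-) H diag
    by (intro eq_matI) (auto simp: lie_mat_unit_index smult_mat_unit_index
        mat_unit_carrier[THEN carrier_matD(1)] mat_unit_carrier[THEN carrier_matD(2)]
        simp del: index_smult_mat(1))
qed

section \<open>Clifford multiplication by root vectors\<close>

lemma clifford_mult_pos:
  assumes "(i, j) \<in> pos_roots p q"
  shows "clifford_mult p q (c \<cdot>\<^sub>m mat_unit (p+q) i j) \<omega> = (\<lambda>A. c * wedge (i, j) \<omega> A)"
proof
  fix A
  have "clifford_mult p q (c \<cdot>\<^sub>m mat_unit (p+q) i j) \<omega> A =
      (\<Sum>\<alpha>\<in>pos_roots p q. if \<alpha> = (i, j) then c * wedge \<alpha> \<omega> A else 0)"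
    unfolding clifford_mult_def using assms
    by (intro sum.cong) (auto simp: pos_roots_def killing_root_vector smult_mat_unit_index mat_unit_index
        split: if_splits)
  also have "\<dots> = c * wedge (i, j) \<omega> A"
    using assms by (simp add: pos_roots_def)
  finally show "clifford_mult p q (c \<cdot>\<^sub>m mat_unit (p+q) i j) \<omega> A = c * wedge (i, j) \<omega> A" .
qed

text \<open>The factor 4n is the 2 of the Clifford normalisation times the Killing value 2n of two
  opposite root vectors.\<close>

lemma clifford_mult_neg:
  assumes "(i, j) \<in> pos_roots p q"
  shows "clifford_mult p q (c \<cdot>\<^sub>m mat_unit (p+q) j i) \<omega> =
    (\<lambda>A. 4 * of_nat (p+q) * c * contract (i, j) \<omega> A)"
proof
  fix A
  have "clifford_mult p q (c \<cdot>\<^sub>m mat_unit (p+q) j i) \<omega> A =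
      (\<Sum>\<alpha>\<in>pos_roots p q. if \<alpha> = (i, j) then 4 * of_nat (p+q) * c * contract \<alpha> \<omega> A else 0)"
    unfolding clifford_mult_def using assms
    by (intro sum.cong) (auto simp: pos_roots_def killing_root_vector smult_mat_unit_index mat_unit_index
        split: if_splits)
  also have "\<dots> = 4 * of_nat (p+q) * c * contract (i, j) \<omega> A"
    using assms by (simp add: pos_roots_def)
  finally show "clifford_mult p q (c \<cdot>\<^sub>m mat_unit (p+q) j i) \<omega> A = 4 * of_nat (p+q) * c * contract (i, j) \<omega> A" .
qed

text \<open>The sign counts only elements strictly below \<alpha>, so it does not see whether
  \<alpha> itself is present. Hence \<open>wedge\<close> and \<open>contract\<close> contribute the
  same sign, and it cancels in their compositions.\<close>

lemma ext_sign_insert: "ext_sign \<alpha> (insert \<alpha> A) = ext_sign \<alpha> A"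
  and ext_sign_remove: "ext_sign \<alpha> (A - {\<alpha>}) = ext_sign \<alpha> A"
  by (auto simp: ext_sign_def intro!: arg_cong[where f = "\<lambda>B. (-1) ^ card B"])

lemma ext_sign_square: "ext_sign \<alpha> A * (ext_sign \<alpha> A * z) = z"
  by (simp add: ext_sign_def flip: mult.assoc power_add)

lemma wedge_contract: "wedge \<alpha> (\<lambda>A. c * contract \<alpha> \<omega> A) = (\<lambda>A. if \<alpha> \<in> A then c * \<omega> A else 0)"
  by (intro ext) (auto simp: wedge_def contract_def ext_sign_remove insert_absorb ext_sign_square mult.left_commute)

lemma contract_wedge: "contract \<alpha> (wedge \<alpha> \<omega>) = (\<lambda>A. if \<alpha> \<in> A then 0 else \<omega> A)"
  by (auto simp: wedge_def contract_def ext_sign_insert ext_sign_square)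

text \<open>The torus acts diagonally in the basis \<open>e_A\<close>. The formula holds at each
  coordinate of an arbitrary \<omega>, so the weight of any weight vector can be read off at one
  nonzero coordinate.\<close>

lemma spin_action_cartan:
  assumes H: "H \<in> cartan (p+q)"
  shows "spin_action p q H \<omega> A =
    (\<Sum>(i, j)\<in>pos_roots p q. (if (i, j) \<in> A then 1/2 else -1/2) * (H $$ (i, i) - H $$ (j, j))) * \<omega> A"
proof -
  let ?n = "p + q"
  let ?f = "\<lambda>(i, j). 1 / killing ?n (mat_unit ?n i j) (mat_unit ?n j i)
      * clifford_mult p q (lie H (mat_unit ?n i j)) (clifford_mult p q (mat_unit ?n j i) \<omega>) A"
  have pos: "clifford_mult p q (mat_unit ?n i j) \<omega> = wedge (i, j) \<omega>"
    and neg: "clifford_mult p q (mat_unit ?n j i) \<omega> = (\<lambda>A. 4 * of_nat ?n * contract (i, j) \<omega> A)"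
    if "(i, j) \<in> pos_roots p q" for i j
  proof -
    have one: "1 \<cdot>\<^sub>m mat_unit ?n k l = mat_unit ?n k l" for k l by auto
    show "clifford_mult p q (mat_unit ?n i j) \<omega> = wedge (i, j) \<omega>"
      "clifford_mult p q (mat_unit ?n j i) \<omega> = (\<lambda>A. 4 * of_nat ?n * contract (i, j) \<omega> A)"
      using clifford_mult_pos[OF that, of 1] clifford_mult_neg[OF that, of 1] by (simp_all add: one)
  qed
  have "sum ?f (perp_roots p q) = sum ?f (pos_roots p q) + sum ?f ({p..<p+q} \<times> {0..<p})"
    unfolding perp_roots_eq by (rule sum.union_disjoint) (auto simp: pos_roots_def)
  \<comment> \<open>Each negative root is matched with its opposite, so that every positive root
    collects both orders of \<open>wedge\<close> and \<open>contract\<close>.\<close>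
  also have "sum ?f ({p..<p+q} \<times> {0..<p}) = (\<Sum>(i, j)\<in>pos_roots p q. ?f (j, i))"
    by (rule sum.reindex_bij_witness[of _ prod.swap prod.swap]) (auto simp: pos_roots_def)
  also have "sum ?f (pos_roots p q) + \<dots> = (\<Sum>(i, j)\<in>pos_roots p q. ?f (i, j) + ?f (j, i))"
    by (simp add: split_def sum.distrib)
  \<comment> \<open>\<open>ad H\<close> scales opposite root vectors by opposite numbers, and 4n
    divided by the Killing value 2n leaves 2, written as 4 times 1/2. The 4 cancels against the 1/4
    in \<open>spin_action\<close>.\<close>
  also have "\<dots> = (\<Sum>(i, j)\<in>pos_roots p q.
      4 * ((if (i, j) \<in> A then 1/2 else -1/2) * (H $$ (i, i) - H $$ (j, j)) * \<omega> A))"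
  proof (intro sum.cong refl)
    fix \<alpha> assume "\<alpha> \<in> pos_roots p q"
    then obtain i j where \<alpha>: "\<alpha> = (i, j)" and ij: "(i, j) \<in> pos_roots p q" by (cases \<alpha>) auto
    then have lt: "i < ?n" "j < ?n" "i \<noteq> j" by (auto simp: pos_roots_def)
    then have nz: "(of_nat ?n :: complex) \<noteq> 0" by (simp only: of_nat_eq_0_iff)
    have "?f (i, j) + ?f (j, i) = 4 * ((if (i, j) \<in> A then 1/2 else -1/2) * (H $$ (i, i) - H $$ (j, j)) * \<omega> A)"
      using nz lt by (simp add: lie_cartan_mat_unit[OF H] clifford_mult_pos[OF ij] clifford_mult_neg[OF ij]
          pos[OF ij] neg[OF ij] wedge_contract contract_wedge killing_mat_unit mat_unit_index
          del: of_nat_add) (auto simp: field_simps)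
    then show "(case \<alpha> of (i, j) \<Rightarrow> ?f (i, j) + ?f (j, i)) = (case \<alpha> of (i, j) \<Rightarrow>
        4 * ((if (i, j) \<in> A then 1/2 else -1/2) * (H $$ (i, i) - H $$ (j, j)) * \<omega> A))"
      by (simp only: \<alpha> prod.case)
  qed
  also have "\<dots> = 4 * ((\<Sum>(i, j)\<in>pos_roots p q.
      (if (i, j) \<in> A then 1/2 else -1/2) * (H $$ (i, i) - H $$ (j, j))) * \<omega> A)"
    by (simp add: split_def sum_distrib_left sum_distrib_right)
  finally show ?thesis
    by (simp only: spin_action_def) simp
qed

section \<open>The Gale-Ryser theorem\<close>

definition row_sum :: "(nat \<times> nat) set \<Rightarrow> nat \<Rightarrow> nat" where
  "row_sum A i = card {j. (i, j) \<in> A}"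

definition col_sum :: "(nat \<times> nat) set \<Rightarrow> nat \<Rightarrow> nat" where
  "col_sum A j = card {i. (i, j) \<in> A}"

text \<open>Double counting of the cells in the first \<open>k\<close> columns; \<open>k\<close> may
  exceed \<open>q\<close>.\<close>

lemma sum_prefix_col_sum:
  assumes "A \<subseteq> {..<p} \<times> {..<q}"
  shows "(\<Sum>j<k. col_sum A j) = (\<Sum>i<p. card {j. (i, j) \<in> A \<and> j < k})"
proof -
  have "(\<Sum>j<k. col_sum A j) = (\<Sum>j<k. \<Sum>i<p. if (i, j) \<in> A then 1 else 0)"
    using assms by (intro sum.cong) (auto simp: col_sum_def sum.If_cases intro!: arg_cong[where f = card])
  also have "\<dots> = (\<Sum>i<p. \<Sum>j<k. if (i, j) \<in> A then 1 else 0)"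
    by (rule sum.swap)
  also have "\<dots> = (\<Sum>i<p. card {j. (i, j) \<in> A \<and> j < k})"
    by (intro sum.cong) (auto simp: sum.If_cases intro!: arg_cong[where f = card])
  finally show ?thesis .
qed

lemma sum_col_sum_eq_sum_row_sum:
  assumes "A \<subseteq> {..<p} \<times> {..<q}"
  shows "(\<Sum>j<q. col_sum A j) = (\<Sum>i<p. row_sum A i)"
proof -
  have "{j. (i, j) \<in> A \<and> j < q} = {j. (i, j) \<in> A}" for i using assms by auto
  then show ?thesis by (simp add: sum_prefix_col_sum[OF assms] row_sum_def)
qed

text \<open>Both sides count the cells in the first \<open>k\<close> columns of the diagram with
  left-justified rows of lengths \<open>a i\<close>.\<close>

lemma sum_prefix_conjugate:
  assumes "\<And>i. p \<le> i \<Longrightarrow> a i = 0"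
  shows "(\<Sum>j<k. conjugate_partition a j) = (\<Sum>i<p. min (a i) k)"
proof -
  have "(\<Sum>j<k. conjugate_partition a j) = (\<Sum>j<k. \<Sum>i<p. if j < a i then 1 else 0)"
  proof (intro sum.cong refl)
    fix j
    have "{i. j < a i} = {i. i < p \<and> j < a i}" using assms by (intro Collect_cong) (metis not_le not_less_zero)
    then show "conjugate_partition a j = (\<Sum>i<p. if j < a i then 1 else 0)"
      by (auto simp: conjugate_partition_def sum.If_cases intro!: arg_cong[where f = card])
  qed
  also have "\<dots> = (\<Sum>i<p. \<Sum>j<k. if j < a i then 1 else 0)"
    by (rule sum.swap)
  also have "\<dots> = (\<Sum>i<p. min (a i) k)"
  proof (intro sum.cong refl)
    fix i
    have "{..<k} \<inter> {j. j < a i} = {..<min (a i) k}" by auto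
    then show "(\<Sum>j<k. if j < a i then 1 else 0) = min (a i) k" by (simp add: sum.If_cases)
  qed
  finally show ?thesis .
qed

text \<open>The easy half of Gale-Ryser: within the first \<open>k\<close> columns, a row has at
  most \<open>k\<close> cells and at most as many as the whole row.\<close>

lemma col_sum_dominated:
  assumes A: "A \<subseteq> {..<p} \<times> {..<q}"
  shows "dominance_le (col_sum A) (conjugate_partition (row_sum A))"
  unfolding dominance_le_def
proof
  fix k
  have fin: "finite {j. (i, j) \<in> A}" for i
    by (rule finite_subset[of _ "{..<q}"]) (use A in auto)
  have "row_sum A i = 0" if "p \<le> i" for i
    using A that by (auto simp: row_sum_def intro!: card_eq_0_iff[THEN iffD2])
  then have "(\<Sum>j<k. conjugate_partition (row_sum A) j) = (\<Sum>i<p. min (row_sum A i) k)"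
    by (rule sum_prefix_conjugate)
  moreover have "card {j. (i, j) \<in> A \<and> j < k} \<le> min (row_sum A i) k" for i
    using card_mono[OF fin, of "{j. (i, j) \<in> A \<and> j < k}" i] card_mono[of "{..<k}" "{j. (i, j) \<in> A \<and> j < k}"]
    by (auto simp: row_sum_def)
  ultimately show "(\<Sum>j<k. col_sum A j) \<le> (\<Sum>j<k. conjugate_partition (row_sum A) j)"
    by (simp add: sum_prefix_col_sum[OF A] sum_mono)
qed

text \<open>
  Moving a cell from the first column that is too full to the first later column that is
  too short keeps all prefix sums of the column sums above those of \<open>b\<close>.  No
  monotonicity of the column sums of \<open>A\<close> is needed.
\<close>
lemma transport_columns:
  assumes "A \<subseteq> {..<p} \<times> {..<q}" "antimono b"
    and "\<And>k. (\<Sum>j<k. b j) \<le> (\<Sum>j<k. col_sum A j)"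
    and "(\<Sum>j<q. b j) = (\<Sum>j<q. col_sum A j)"
  shows "\<exists>B \<subseteq> {..<p} \<times> {..<q}. row_sum B = row_sum A \<and> (\<forall>j<q. col_sum B j = b j)"
  using assms
\<comment> \<open>The measure drops whenever a cell moves to the right inside the rectangle.\<close>
proof (induction "\<Sum>x\<in>A. q - snd x" arbitrary: A rule: less_induct)
  case less
  note A = less.prems(1) and anti = less.prems(2) and dom = less.prems(3) and total = less.prems(4)
  show ?case
  proof (cases "\<forall>j<q. col_sum A j = b j")
    case True
    then show ?thesis using A by blast
  next
    case False
    define i where "i = (LEAST i. i < q \<and> col_sum A i \<noteq> b i)"
    have i: "i < q" "col_sum A i \<noteq> b i"
      using False LeastI_ex[of "\<lambda>i. i < q \<and> col_sum A i \<noteq> b i"] by (auto simp: i_def)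
    have before: "col_sum A l = b l" if "l < i" for l
      using not_less_Least[of l "\<lambda>i. i < q \<and> col_sum A i \<noteq> b i"] that i by (auto simp: i_def)
    then have pre: "(\<Sum>l<i. b l) = (\<Sum>l<i. col_sum A l)" by simp
    \<comment> \<open>The prefixes before \<open>i\<close> agree, so dominance at the next prefix
      forces the first deviation to be a surplus.\<close>
    with dom[of "Suc i"] i have i_gt: "b i < col_sum A i" by simp
    \<comment> \<open>Without a later deficit, the surplus at \<open>i\<close> would make the totals
      differ.\<close>
    have "\<exists>j. i < j \<and> j < q \<and> col_sum A j < b j"
    proof (rule ccontr)
      assume contra: "\<not> ?thesis"
      have "b l \<le> col_sum A l" if "l < q" for l
        using contra that before[of l] i_gt by (metis linorder_cases not_less order_refl less_imp_le)
      then have "(\<Sum>l<q. b l) < (\<Sum>l<q. col_sum A l)"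
        using i i_gt by (intro sum_strict_mono_ex1) auto
      then show False using total by simp
    qed
    define j where "j = (LEAST j. i < j \<and> j < q \<and> col_sum A j < b j)"
    have j: "i < j" "j < q" "col_sum A j < b j"
      using LeastI_ex[OF \<open>\<exists>j. i < j \<and> j < q \<and> col_sum A j < b j\<close>] by (auto simp: j_def)
    have between: "b l \<le> col_sum A l" if "i < l" "l < j" for l
      using not_less_Least[of l "\<lambda>j. i < j \<and> j < q \<and> col_sum A j < b j"] that j by (auto simp: j_def)
    have "finite A" using A finite_subset by blast
    have fin_col: "finite {r. (r, l) \<in> A}" for l
      by (rule finite_subset[of _ "{..<p}"]) (use A in auto)
    have fin_row: "finite {l. (r, l) \<in> A}" for r
      by (rule finite_subset[of _ "{..<q}"]) (use A in auto)
    \<comment> \<open>Here \<open>col_sum A j < b j \<le> b i < col_sum A i\<close>, so some row has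
      a cell in column \<open>i\<close> and none in column \<open>j\<close>.\<close>
    have "col_sum A j < col_sum A i"
      using j i_gt antimonoD[OF anti, of i j] by simp
    then have "\<not> {r. (r, i) \<in> A} \<subseteq> {r. (r, j) \<in> A}"
      using card_mono[OF fin_col, of "{r. (r, i) \<in> A}" j] by (auto simp: col_sum_def)
    then obtain r where r: "(r, i) \<in> A" "(r, j) \<notin> A" by auto
    define B where "B = insert (r, j) (A - {(r, i)})"
    have B: "B \<subseteq> {..<p} \<times> {..<q}" using A r j by (auto simp: B_def)
    have rows: "row_sum B = row_sum A"
    proof
      fix s
      show "row_sum B s = row_sum A s"
      proof (cases "s = r")
        case True
        have "{l. (r, l) \<in> B} = insert j ({l. (r, l) \<in> A} - {i})"
          using j by (auto simp: B_def)
        then have "row_sum B r = Suc (card ({l. (r, l) \<in> A} - {i}))"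
          using r fin_row by (simp add: row_sum_def)
        also have "\<dots> = row_sum A r"
          unfolding row_sum_def using r fin_row by (intro card_Suc_Diff1) auto
        finally show ?thesis using True by simp
      next
        case False
        then show ?thesis by (simp add: row_sum_def B_def)
      qed
    qed
    have col_i: "Suc (col_sum B i) = col_sum A i"
    proof -
      have "{s. (s, i) \<in> B} = {s. (s, i) \<in> A} - {r}" using j by (auto simp: B_def)
      then show ?thesis unfolding col_sum_def using r fin_col
        by (simp add: card_Suc_Diff1 del: card_Diff_insert)
    qed
    have col_j: "col_sum B j = Suc (col_sum A j)"
    proof -
      have "{s. (s, j) \<in> B} = insert r {s. (s, j) \<in> A}" using j by (auto simp: B_def)
      then show ?thesis using r fin_col by (simp add: col_sum_def)
    qed
    have col_other: "col_sum B l = col_sum A l" if "l \<noteq> i" "l \<noteq> j" for l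
      using that by (simp add: col_sum_def B_def)
    \<comment> \<open>Prefixes ending at or before column \<open>j\<close> are compared term by
      term: column \<open>i\<close> had at least one cell to spare. Longer prefixes contain both
      ends of the move, so their sums do not change.\<close>
    have low: "b l \<le> col_sum B l" if "l < j" for l
      using that before[of l] between[of l] i_gt col_i col_other[of l]
      by (cases l i rule: linorder_cases) auto
    have high: "(\<Sum>l<k. col_sum B l) = (\<Sum>l<k. col_sum A l)" if "j < k" for k
    proof -
      have split: "(\<Sum>l<k. f l) = f i + (f j + (\<Sum>l\<in>{..<k} - {i} - {j}. f l))" for f :: "nat \<Rightarrow> nat"
        using that j by (subst sum.remove[of _ i], simp, simp, subst sum.remove[of _ j]) auto
      have "(\<Sum>l\<in>{..<k} - {i} - {j}. col_sum B l) = (\<Sum>l\<in>{..<k} - {i} - {j}. col_sum A l)"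
        by (intro sum.cong) (auto simp: col_other)
      then show ?thesis using col_i col_j by (simp add: split)
    qed
    have "(\<Sum>l<k. b l) \<le> (\<Sum>l<k. col_sum B l)" for k
    proof (cases "k \<le> j")
      case True
      then show ?thesis by (intro sum_mono low) auto
    next
      case False
      then show ?thesis using dom[of k] high[of k] by simp
    qed
    moreover have "(\<Sum>l<q. b l) = (\<Sum>l<q. col_sum B l)"
      using total high[of q] j by simp
    moreover have "(\<Sum>x\<in>B. q - snd x) < (\<Sum>x\<in>A. q - snd x)"
      using \<open>finite A\<close> r j by (auto simp: B_def sum.remove[of A "(r, i)"])
    ultimately obtain C where "C \<subseteq> {..<p} \<times> {..<q}" "row_sum C = row_sum B" "\<forall>j<q. col_sum C j = b j"
      using less.hyps[of B] B anti by blast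
    then show ?thesis using rows by auto
  qed
qed

text \<open>The left-justified diagram with row lengths \<open>a i\<close> has the conjugate of
  \<open>a\<close> as its column sums; moving cells to the right then turns these into
  \<open>b\<close> without changing the row sums.\<close>

theorem gale_ryser:
  assumes a: "\<And>i. p \<le> i \<Longrightarrow> a i = 0" and b: "antimono b" "\<And>j. q \<le> j \<Longrightarrow> b j = 0"
    and total: "(\<Sum>i<p. a i) = (\<Sum>j<q. b j)"
    and dom: "dominance_le b (conjugate_partition a)"
  obtains A where "A \<subseteq> {..<p} \<times> {..<q}" "row_sum A = a" "col_sum A = b"
proof -
  have prefix: "(\<Sum>j<k. conjugate_partition a j) = (\<Sum>i<p. min (a i) k)" for k
    using a by (rule sum_prefix_conjugate)
  \<comment> \<open>Dominance at \<open>k = q\<close>, where \<open>b\<close> is exhausted, bounds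
    the total by the number of diagram cells in the first \<open>q\<close> columns. So no row is
    longer than \<open>q\<close>, and the diagram fits into the rectangle.\<close>
  have a_le: "a i \<le> q" for i
  proof (cases "i < p")
    case True
    have "(\<Sum>i<p. a i) \<le> (\<Sum>i<p. min (a i) q)"
      using dom by (simp add: total dominance_le_def flip: prefix)
    moreover have "(\<Sum>i<p. min (a i) q) < (\<Sum>i<p. a i)" if "q < a i"
      using True that by (intro sum_strict_mono_ex1 bexI[of _ i]) auto
    ultimately show ?thesis by (meson not_le)
  qed (simp add: a)
  define F where "F = {(i, j). j < a i}"
  have F: "F \<subseteq> {..<p} \<times> {..<q}"
  proof (rule subrelI)
    fix i j assume "(i, j) \<in> F"
    then have "j < a i" by (simp add: F_def)
    then show "(i, j) \<in> {..<p} \<times> {..<q}"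
      using a[of i] a_le[of i] by (cases "i < p") auto
  qed
  have row: "row_sum F = a" by (auto simp: row_sum_def F_def)
  have col: "col_sum F = conjugate_partition a"
    by (auto simp: col_sum_def F_def conjugate_partition_def)
  have "(\<Sum>j<q. b j) = (\<Sum>j<q. col_sum F j)"
    using sum_col_sum_eq_sum_row_sum[OF F] total by (simp add: row)
  then obtain A where A: "A \<subseteq> {..<p} \<times> {..<q}" "row_sum A = a" "\<forall>j<q. col_sum A j = b j"
    using transport_columns[OF F b(1)] dom by (auto simp: dominance_le_def col row)
  have "col_sum A j = b j" for j
    using A b(2) by (cases "j < q") (auto simp: col_sum_def intro!: card_eq_0_iff[THEN iffD2])
  then show ?thesis using A that by blast
qed

section \<open>The weights of the spin module\<close>

lemma sum_signs:
  assumes "finite T" "S \<subseteq> T"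
  shows "(\<Sum>x\<in>T. if x \<in> S then 1/2 else - 1/2 :: complex) = of_nat (card S) - of_nat (card T) / 2"
proof -
  have "T \<inter> {x. x \<in> S} = S" "T \<inter> - S = T - S" using assms by auto
  moreover have "finite S" "card S \<le> card T" using assms finite_subset card_mono by auto
  ultimately show ?thesis
    using assms by (simp add: sum.If_cases card_Diff_subset of_nat_diff field_simps)
qed

text \<open>Adding the signs along row \<open>i\<close> gives \<open>row_sum B i - q/2\<close>;
  along column \<open>c\<close> it gives \<open>col_sum B c - p/2\<close>, which enters negatively.
  Taking \<open>h\<close> constant gives the zero coordinate sum, and taking the diagonal of
  \<open>H\<close> gives the torus eigenvalue.\<close>

lemma sum_pair_weight:
  assumes B: "B \<subseteq> {..<p} \<times> {..<q}"
  shows "(\<Sum>i<p+q. pair_weight p q (row_sum B) (col_sum B) $ i * h i) =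
    (\<Sum>i<p. \<Sum>c<q. (if (i, c) \<in> B then 1/2 else - 1/2) * (h i - h (p + q - 1 - c)))"
proof -
  let ?s = "\<lambda>i c. if (i, c) \<in> B then 1/2 else - 1/2 :: complex"
  let ?w = "pair_weight p q (row_sum B) (col_sum B)"
  have row: "(\<Sum>c<q. ?s i c) = of_nat (row_sum B i) - of_nat q / 2" for i
    using sum_signs[of "{..<q}" "{c. (i, c) \<in> B}"] B by (auto simp: row_sum_def)
  have col: "(\<Sum>i<p. ?s i c) = of_nat (col_sum B c) - of_nat p / 2" for c
    using sum_signs[of "{..<p}" "{i. (i, c) \<in> B}"] B by (auto simp: col_sum_def)
  have "(\<Sum>i<p+q. ?w $ i * h i) = (\<Sum>i<p. ?w $ i * h i) + (\<Sum>j\<in>{p..<p+q}. ?w $ j * h j)"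
    by (subst sum.union_disjoint[symmetric]) (auto intro!: sum.cong)
  also have "(\<Sum>i<p. ?w $ i * h i) = (\<Sum>i<p. \<Sum>c<q. ?s i c * h i)"
    by (intro sum.cong) (auto simp: pair_weight_def row simp flip: sum_distrib_right)
  also have "(\<Sum>j\<in>{p..<p+q}. ?w $ j * h j) = (\<Sum>c<q. ?w $ (p + q - 1 - c) * h (p + q - 1 - c))"
    by (rule sum.reindex_bij_witness[of _ "\<lambda>c. p + q - 1 - c" "\<lambda>c. p + q - 1 - c"]) auto
  also have "\<dots> = (\<Sum>c<q. - (\<Sum>i<p. ?s i c * h (p + q - 1 - c)))"
    by (intro sum.cong) (auto simp: pair_weight_def col left_diff_distrib simp flip: sum_distrib_right)
  also have "\<dots> = - (\<Sum>i<p. \<Sum>c<q. ?s i c * h (p + q - 1 - c))"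
    unfolding sum_negf by (subst sum.swap) simp
  finally show ?thesis by (simp add: right_diff_distrib sum_subtractf)
qed

lemma sum_pair_weight_eq_0:
  assumes "B \<subseteq> {..<p} \<times> {..<q}"
  shows "(\<Sum>i<p+q. pair_weight p q (row_sum B) (col_sum B) $ i) = 0"
  using sum_pair_weight[OF assms, of "\<lambda>_. 1"] by simp

text \<open>Column \<open>c\<close> of \<open>B\<close> corresponds to the coordinate \<open>p + q - 1 - c\<close>, as in \<^const>\<open>pair_weight\<close>.\<close>
lemma spin_action_pair_weight:
  assumes H: "H \<in> cartan (p+q)" and B: "B \<subseteq> {..<p} \<times> {..<q}"
    and AB: "\<And>i j. (i, j) \<in> pos_roots p q \<Longrightarrow> (i, j) \<in> A \<longleftrightarrow> (i, p + q - 1 - j) \<in> B"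
  shows "spin_action p q H \<omega> A =
    (\<Sum>i<p+q. pair_weight p q (row_sum B) (col_sum B) $ i * H $$ (i, i)) * \<omega> A"
proof -
  have "(\<Sum>(i, j)\<in>pos_roots p q. (if (i, j) \<in> A then 1/2 else -1/2) * (H $$ (i, i) - H $$ (j, j)))
    = (\<Sum>(i, c)\<in>{..<p} \<times> {..<q}. (if (i, c) \<in> B then 1/2 else -1/2) *
        (H $$ (i, i) - H $$ (p + q - 1 - c, p + q - 1 - c)))"
    by (rule sum.reindex_bij_witness[of _ "\<lambda>(i, c). (i, p + q - 1 - c)" "\<lambda>(i, j). (i, p + q - 1 - j)"])
      (auto simp: AB, auto simp: pos_roots_def)
  then show ?thesis
    by (simp add: spin_action_cartan[OF H] sum_pair_weight[OF B] sum.cartesian_product)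
qed

text \<open>
  Since the coordinates of \<open>b - b'\<close> add up to zero, the diagonal matrix with the conjugate entries
  lies in the Cartan subalgebra.
\<close>
lemma cartan_functional_inj:
  assumes b: "b \<in> carrier_vec n" "(\<Sum>i<n. b $ i) = 0"
    and b': "b' \<in> carrier_vec n" "(\<Sum>i<n. b' $ i) = 0"
    and eq: "\<And>H. H \<in> cartan n \<Longrightarrow> (\<Sum>i<n. b $ i * H $$ (i, i)) = (\<Sum>i<n. b' $ i * H $$ (i, i))"
  shows "b = b'"
proof -
  define H where "H = mat n n (\<lambda>(i, j). if i = j then cnj (b $ i - b' $ i) else 0)"
  have diag: "H $$ (i, i) = cnj (b $ i - b' $ i)" if "i < n" for i
    using that by (simp add: H_def)
  have "(\<Sum>i<n. H $$ (i, i)) = cnj (\<Sum>i<n. b $ i - b' $ i)"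
    by (simp add: diag)
  also have "\<dots> = 0" using b b' by (simp only: sum_subtractf) simp
  finally have "H \<in> cartan n" by (auto simp: cartan_def sl_def H_def)
  then have "(\<Sum>i<n. (b $ i - b' $ i) * H $$ (i, i)) = 0"
    using eq by (simp add: left_diff_distrib sum_subtractf)
  \<comment> \<open>The conjugate entries turn the difference of the functionals into a sum of
    squared moduli, which vanishes only termwise.\<close>
  also have "(\<Sum>i<n. (b $ i - b' $ i) * H $$ (i, i)) = of_real (\<Sum>i<n. (cmod (b $ i - b' $ i))\<^sup>2)"
    unfolding of_real_sum by (intro sum.cong refl) (simp only: diag lessThan_iff complex_norm_square)
  finally have "\<forall>i\<in>{..<n}. (cmod (b $ i - b' $ i))\<^sup>2 = 0"
    by (subst sum_nonneg_eq_0_iff[symmetric]) (auto simp only: of_real_eq_0_iff finite_lessThan zero_le_power2)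
  then show ?thesis using b b' by (intro eq_vecI) auto
qed

text \<open>A weight vector may mix basis vectors, but diagonality forces each nonzero coordinate to
  carry the same functional. Conversely, each 0-1 matrix gives the weight of one basis
  vector.\<close>

lemma spin_weights_eq:
  "spin_weights p q = {pair_weight p q (row_sum B) (col_sum B) |B. B \<subseteq> {..<p} \<times> {..<q}}"
proof (intro equalityI subsetI)
  fix b assume "b \<in> spin_weights p q"
  then obtain \<omega> where b: "b \<in> carrier_vec (p+q)" "(\<Sum>i<p+q. b $ i) = 0"
    and \<omega>: "\<omega> \<in> spin_module p q" "\<omega> \<noteq> (\<lambda>A. 0)"
    and wt: "\<And>H. H \<in> cartan (p+q) \<Longrightarrow>
      spin_action p q H \<omega> = (\<lambda>A. (\<Sum>i<p+q. b $ i * H $$ (i, i)) * \<omega> A)"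
    unfolding spin_weights_def by blast
  from \<omega>(2) obtain A where A: "\<omega> A \<noteq> 0" by auto
  define B where "B = {(i, c). i < p \<and> c < q \<and> (i, p + q - 1 - c) \<in> A}"
  have B: "B \<subseteq> {..<p} \<times> {..<q}" by (auto simp: B_def)
  have AB: "(i, j) \<in> A \<longleftrightarrow> (i, p + q - 1 - j) \<in> B" if "(i, j) \<in> pos_roots p q" for i j
    using that by (auto simp: B_def pos_roots_def)
  have "b = pair_weight p q (row_sum B) (col_sum B)"
  proof (rule cartan_functional_inj[OF b _ sum_pair_weight_eq_0[OF B]])
    fix H assume H: "H \<in> cartan (p+q)"
    have "spin_action p q H \<omega> A =
        (\<Sum>i<p+q. pair_weight p q (row_sum B) (col_sum B) $ i * H $$ (i, i)) * \<omega> A"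
      by (rule spin_action_pair_weight[OF H B AB])
    also have "spin_action p q H \<omega> A = (\<Sum>i<p+q. b $ i * H $$ (i, i)) * \<omega> A"
      by (rule fun_cong[OF wt[OF H]])
    finally show "(\<Sum>i<p+q. b $ i * H $$ (i, i)) =
        (\<Sum>i<p+q. pair_weight p q (row_sum B) (col_sum B) $ i * H $$ (i, i))"
      using A by (simp only: mult_cancel_right) blast
  qed (simp add: pair_weight_def)
  then show "b \<in> {pair_weight p q (row_sum B) (col_sum B) |B. B \<subseteq> {..<p} \<times> {..<q}}"
    using B by blast
next
  fix b assume "b \<in> {pair_weight p q (row_sum B) (col_sum B) |B. B \<subseteq> {..<p} \<times> {..<q}}"
  then obtain B where B: "B \<subseteq> {..<p} \<times> {..<q}" and b: "b = pair_weight p q (row_sum B) (col_sum B)"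
    by blast
  define A where "A = {(i, j) \<in> pos_roots p q. (i, p + q - 1 - j) \<in> B}"
  define \<omega> :: "(nat \<times> nat) set \<Rightarrow> complex" where "\<omega> = (\<lambda>C. if C = A then 1 else 0)"
  have "\<omega> \<in> spin_module p q" by (auto simp: spin_module_def \<omega>_def A_def)
  moreover have "\<omega> \<noteq> (\<lambda>A. 0)" by (simp add: \<omega>_def fun_eq_iff)
  moreover have "spin_action p q H \<omega> = (\<lambda>C. (\<Sum>i<p+q. b $ i * H $$ (i, i)) * \<omega> C)"
    if H: "H \<in> cartan (p+q)" for H
  proof
    fix C
    show "spin_action p q H \<omega> C = (\<Sum>i<p+q. b $ i * H $$ (i, i)) * \<omega> C"
    proof (cases "C = A")
      case True
      have "(i, j) \<in> A \<longleftrightarrow> (i, p + q - 1 - j) \<in> B" if "(i, j) \<in> pos_roots p q" for i j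
        using that by (simp add: A_def)
      then show ?thesis unfolding True b by (rule spin_action_pair_weight[OF H B])
    next
      case False
      then show ?thesis by (simp add: spin_action_cartan[OF H] \<omega>_def)
    qed
  qed
  ultimately have "\<exists>\<omega> \<in> spin_module p q. \<omega> \<noteq> (\<lambda>A. 0) \<and> (\<forall>H \<in> cartan (p + q).
      spin_action p q H \<omega> = (\<lambda>A. (\<Sum>i<p+q. b $ i * H $$ (i, i)) * \<omega> A))"
    by (intro bexI[of _ \<omega>] conjI ballI)
  moreover have "b \<in> carrier_vec (p+q)" by (simp add: b pair_weight_def)
  moreover have "(\<Sum>i<p+q. b $ i) = 0" unfolding b by (rule sum_pair_weight_eq_0[OF B])
  ultimately show "b \<in> spin_weights p q"
    unfolding spin_weights_def by (intro CollectI conjI)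
qed

section \<open>Partitions with a bounded number of parts\<close>

text \<open>By monotonicity, a nonzero entry at index \<open>i\<close> yields \<open>i + 1\<close>
  nonzero parts, more than \<open>p\<close>.\<close>

lemma partition_eq_0:
  assumes "is_partition_of m a" "num_parts a \<le> p" "p \<le> i"
  shows "a i = 0"
proof (rule ccontr)
  assume nz: "a i \<noteq> 0"
  have "a i \<le> a j" if "j \<le> i" for j
    using assms(1) that by (simp add: is_partition_of_def antimonoD)
  with nz have "{..i} \<subseteq> {i. a i \<noteq> 0}" by force
  then have "card {..i} \<le> num_parts a"
    unfolding num_parts_def using assms(1) by (intro card_mono) (auto simp: is_partition_of_def)
  then show False using assms by simp
qed

lemma support_subset:
  fixes a :: "nat \<Rightarrow> nat"
  assumes "\<And>i. p \<le> i \<Longrightarrow> a i = 0"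
  shows "{i. a i \<noteq> 0} \<subseteq> {..<p}"
proof
  fix i assume "i \<in> {i. a i \<noteq> 0}"
  then show "i \<in> {..<p}" by (cases "i < p") (simp_all add: assms)
qed

lemma sum_support:
  fixes a :: "nat \<Rightarrow> nat"
  assumes "\<And>i. p \<le> i \<Longrightarrow> a i = 0"
  shows "(\<Sum>i | a i \<noteq> 0. a i) = (\<Sum>i<p. a i)"
  by (rule sum.mono_neutral_left) (use support_subset[OF assms] in \<open>simp_all\<close>)

lemma num_parts_le:
  assumes "\<And>i. p \<le> i \<Longrightarrow> a i = 0"
  shows "num_parts a \<le> p"
  using card_mono[OF _ support_subset[OF assms]] by (simp add: num_parts_def)

lemma is_partition_of_sum:
  assumes "\<And>i. p \<le> i \<Longrightarrow> a i = 0" and "\<And>i j. i \<le> j \<Longrightarrow> j < p \<Longrightarrow> a j \<le> a i"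
  shows "is_partition_of (\<Sum>i<p. a i) a"
  unfolding is_partition_of_def
proof (intro conjI)
  show "antimono a"
    using assms by (intro antimonoI) (metis le0 not_le)
  show "finite {i. a i \<noteq> 0}"
    by (rule finite_subset[OF support_subset[OF assms(1)] finite_lessThan])
qed (rule sum_support[OF assms(1)])

section \<open>The bijection between dominated pairs and dominant weights\<close>

theorem corollary5p3:
  fixes p q :: nat
  assumes "p \<ge> 1" and "q \<ge> 1"
  shows "bij_betw (\<lambda>(a, b). pair_weight p q a b) (dominance_pairs p q) (dominant_spin_weights p q)"
proof -
  have left: "pair_weight p q a b $ i = of_nat (a i) - of_nat q / 2" if "i < p" for a b i
    using that by (simp add: pair_weight_def)
  have right: "pair_weight p q a b $ j = of_nat p / 2 - of_nat (b (p + q - 1 - j))"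
    if "p \<le> j" "j < p + q" for a b j
    using that by (simp add: pair_weight_def)
  \<comment> \<open>The weight determines the entries of index below \<open>p\<close> and
    \<open>q\<close>; all later ones are zero, so the infinite sequences agree.\<close>
  have "inj_on (\<lambda>(a, b). pair_weight p q a b) (dominance_pairs p q)"
  proof (rule inj_onI, clarify)
    fix a b a' b'
    assume "(a, b) \<in> dominance_pairs p q" "(a', b') \<in> dominance_pairs p q"
    then have zero: "\<And>i. p \<le> i \<Longrightarrow> a i = 0" "\<And>i. p \<le> i \<Longrightarrow> a' i = 0"
        "\<And>j. q \<le> j \<Longrightarrow> b j = 0" "\<And>j. q \<le> j \<Longrightarrow> b' j = 0"
      by (auto simp: dominance_pairs_def partition_pairs_def dest: partition_eq_0)
    assume eq: "pair_weight p q a b = pair_weight p q a' b'"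
    have "a i = a' i" for i
      using zero left[of i a b] left[of i a' b'] eq by (cases "i < p") auto
    moreover have "b j = b' j" for j
      using zero right[of "p + q - 1 - j" a b] right[of "p + q - 1 - j" a' b'] eq
      by (cases "j < q") auto
    ultimately show "a = a' \<and> b = b'" by blast
  qed
  \<comment> \<open>Gale-Ryser supplies a 0-1 matrix with these margins, and hence a basis vector of
    this weight.\<close>
  moreover have "pair_weight p q a b \<in> dominant_spin_weights p q"
    if ab: "(a, b) \<in> dominance_pairs p q" for a b
  proof -
    obtain m where a: "is_partition_of m a" "num_parts a \<le> p" and b: "is_partition_of m b" "num_parts b \<le> q"
      and dom: "dominance_le b (conjugate_partition a)"
      using ab by (auto simp: dominance_pairs_def partition_pairs_def)
    note a0 = partition_eq_0[OF a] and b0 = partition_eq_0[OF b]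
    have anti: "antimono a" "antimono b" using a b by (auto simp: is_partition_of_def)
    have total: "(\<Sum>i<p. a i) = (\<Sum>j<q. b j)"
      using a b sum_support[OF a0] sum_support[OF b0] by (simp add: is_partition_of_def)
    obtain B where "B \<subseteq> {..<p} \<times> {..<q}" "row_sum B = a" "col_sum B = b"
      using gale_ryser[OF a0 anti(2) b0 total dom] by blast
    then have "pair_weight p q a b \<in> spin_weights p q"
      unfolding spin_weights_eq by blast
    then show ?thesis
      using anti by (auto simp: dominant_spin_weights_def left right less_eq_complex_def intro: antimonoD)
  qed
  \<comment> \<open>The preimage consists of the margins of a 0-1 matrix realising \<open>w\<close>.
    Dominance holds for any such matrix, and dominance of the weight makes the margins
    partitions.\<close>
  moreover have "w \<in> (\<lambda>(a, b). pair_weight p q a b) ` dominance_pairs p q"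
    if "w \<in> dominant_spin_weights p q" for w
  proof -
    from that obtain B where B: "B \<subseteq> {..<p} \<times> {..<q}" and w: "w = pair_weight p q (row_sum B) (col_sum B)"
      by (auto simp: dominant_spin_weights_def spin_weights_eq)
    let ?a = "row_sum B" and ?b = "col_sum B"
    have a0: "?a i = 0" if "p \<le> i" for i
      using B that by (auto simp: row_sum_def intro!: card_eq_0_iff[THEN iffD2])
    have b0: "?b j = 0" if "q \<le> j" for j
      using B that by (auto simp: col_sum_def intro!: card_eq_0_iff[THEN iffD2])
    have "?a j \<le> ?a i" if "i \<le> j" "j < p" for i j
    proof -
      have "w $ i \<ge> w $ j" using \<open>w \<in> dominant_spin_weights p q\<close> that by (auto simp: dominant_spin_weights_def)
      then show ?thesis using that by (simp add: w left less_eq_complex_def)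
    qed
    with a0 have pa: "is_partition_of (\<Sum>i<p. ?a i) ?a" by (rule is_partition_of_sum)
    \<comment> \<open>The reversal of coordinates and the minus sign in front of the column sums
      compensate, so decreasing coordinates give decreasing column sums.\<close>
    have "?b j \<le> ?b i" if "i \<le> j" "j < q" for i j
    proof -
      have "p \<le> p + q - 1 - j" "p + q - 1 - j \<le> p + q - 1 - i" "p + q - 1 - i < p + q"
        using that by auto
      then have "w $ (p + q - 1 - j) \<ge> w $ (p + q - 1 - i)"
        using \<open>w \<in> dominant_spin_weights p q\<close> unfolding dominant_spin_weights_def by blast
      then show ?thesis using that by (simp add: w right less_eq_complex_def)
    qed
    with b0 have pb: "is_partition_of (\<Sum>j<q. ?b j) ?b" by (rule is_partition_of_sum)
    have "?a i \<le> q" for i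
      using B card_mono[of "{..<q}" "{c. (i, c) \<in> B}"] by (auto simp: row_sum_def)
    then have "(\<Sum>i<p. ?a i) \<le> p * q"
      using sum_bounded_above[of "{..<p}" ?a q] by simp
    then have "(?a, ?b) \<in> dominance_pairs p q"
      using pa pb num_parts_le[of p ?a] num_parts_le[of q ?b] a0 b0 col_sum_dominated[OF B]
      by (auto simp: dominance_pairs_def partition_pairs_def sum_col_sum_eq_sum_row_sum[OF B])
    then show ?thesis using w by force
  qed
  ultimately show ?thesis unfolding bij_betw_def by auto
qed

end
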